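(* Let $q\in\mathbb{C}$ with $0<|q|<1$, let $b\in\mathbb{C}$, $z\in\mathbb{C}\setminus\{0,1\}$, and let $x,y\in\mathbb{C}\setminus\{0\}$ with $|q/(xy)|<1$ and $x,y\notin\{q^m:m\ge1\}$. Then $$\sum_{n=0}^{\infty}(x,y)_n(1-bq^n)\Big(\frac{q}{xy}\Big)^n\frac{(-1/z,-z)_n}{(q)_{2n}}=\frac{1}{1-z}\,\frac{(q/x,q/y)_\infty}{(q,q/(xy))_\infty}\sum_{n=-\infty}^{\infty}\frac{(x,y)_n\,q^{\binom{n}{2}}\,(q/(xyz))^n}{(q/x,q/y)_n}\Big((1-bq^n)-z(q^n-b)\Big).$$
   Context: $(a)_n=(a;q)_n=\prod_{j=1}^{n}(1-aq^{j-1})$ for $n\ge0$ (with $(a)_0=1$), $(a)_\infty=\prod_{j\ge0}(1-aq^j)$, and $(a,b)_n=(a)_n(b)_n$, likewise for $n=\infty$. For negative indices, $(a)_{-m}=1/\prod_{j=1}^{m}(1-aq^{-j})$ for $m\ge1$, and $1/(a)_{-m}$ denotes $\prod_{j=1}^{m}(1-aq^{-j})$ (which may be $0$). For $m\in\mathbb{Z}$, $\binom{m}{2}=m(m-1)/2$. *)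

theory Defs
  imports "HOL-Analysis.Analysis"
begin

definition qpoch :: "complex \<Rightarrow> complex \<Rightarrow> int \<Rightarrow> complex" where
  "qpoch a q n =
     (if 0 \<le> n then \<Prod>j=1..nat n. 1 - a * q ^ (j - 1)
      else 1 / (\<Prod>j=1..nat (- n). 1 - a * q powi (- int j)))"

(* For |q| < 1 the product converges.  Vanishing factors are allowed; the value is then 0. *)
definition qpoch_inf :: "complex \<Rightarrow> complex \<Rightarrow> complex" where
  "qpoch_inf a q = (\<Prod>j. 1 - a * q ^ j)"

(* The convention that 1/(a)_{-m} denotes a finite product that may be 0 needs no separate
   definition: since 1 / 0 = 0, it holds also when a factor vanishes. *)
lemma one_div_qpoch_neg:
  "1 / qpoch a q (- int m) = (\<Prod>j=1..m. 1 - a * q powi (- int j))"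
  by (cases "m = 0") (simp_all add: qpoch_def)

end

theory Submission
  imports Defs
begin

text \<open>
  Up to the factor \<open>(q/(xy))\<^sup>n (x,y)\<^sub>n / (q/x,q/y)\<^sub>n\<close>, the bilateral summand is
  \<open>A\<^sub>n\<close>, where \<open>A\<^sub>n = q\<^bsup>n(n-1)/2\<^esup> z\<^bsup>-n\<^esup> ((1 - b q\<^sup>n) - z (q\<^sup>n - b))\<close>. Two instances of the
  finite Jacobi triple product show that \<open>\<Sum>\<^bsub>|r| \<le> n\<^esub> A\<^sub>r / ((q)\<^bsub>n-r\<^esub> (q)\<^bsub>n+r\<^esub>)\<close> equals
  \<open>(1 - z) (1 - b q\<^sup>n) (-1/z,-z)\<^sub>n / (q)\<^bsub>2n\<^esub>\<close>. Inserting this on the left-hand side and exchanging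
  the two absolutely convergent summations leaves, for each \<open>r\<close>, an inner sum over \<open>n \<ge> |r|\<close>
  that the q-Gauss theorem evaluates; it depends on \<open>r\<close> only through \<open>|r|\<close>, as does
  \<open>(x,y)\<^sub>r (q/(xy))\<^sup>r / (q/x,q/y)\<^sub>r\<close>. The q-Gauss theorem itself follows by iterating
  the contiguous relation between parameters \<open>c\<close> and \<open>cq\<close>.
\<close>

section \<open>Finite and infinite q-shifted factorials\<close>

text \<open>Natural index and exponents from 0 avoid the truncated \<open>j - 1\<close> and the cast
  to \<open>int\<close> in \<open>qpoch\<close>; \<open>qpoch_of_nat\<close> is the bridge.\<close>

definition qpn :: "complex \<Rightarrow> complex \<Rightarrow> nat \<Rightarrow> complex" where
  "qpn a q n = (\<Prod>j<n. 1 - a * q ^ j)"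

lemma qpn_0 [simp]: "qpn a q 0 = 1"
  by (simp add: qpn_def)

lemma qpn_Suc: "qpn a q (Suc n) = qpn a q n * (1 - a * q ^ n)"
  by (simp add: qpn_def)

lemma qpn_add: "qpn a q (m + k) = qpn a q m * qpn (a * q ^ m) q k"
  by (induction k) (simp_all add: qpn_Suc power_add mult.assoc)

lemma qpn_Suc': "qpn a q (Suc n) = (1 - a) * qpn (a * q) q n"
  using qpn_add[of a q 1 n] by (simp add: qpn_Suc)

lemma qpn_eq_0_iff: "qpn a q n = 0 \<longleftrightarrow> (\<exists>j<n. a * q ^ j = 1)"
  by (auto simp: qpn_def)

lemma qpoch_of_nat: "qpoch a q (int n) = qpn a q n"
proof -
  have "(\<Prod>j=1..n. 1 - a * q ^ (j - 1)) = (\<Prod>j<n. 1 - a * q ^ j)"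
    by (rule prod.reindex_bij_witness[of _ Suc "\<lambda>j. j - 1"]) auto
  then show ?thesis by (simp add: qpoch_def qpn_def)
qed

lemma convergent_prod_qpoch:
  fixes a q :: complex
  assumes "norm q < 1"
  shows "convergent_prod (\<lambda>j. 1 - a * q ^ j)"
proof -
  have "summable (\<lambda>j. norm (1 - a * q ^ j - 1))"
    using assms by (simp add: norm_mult norm_power summable_mult)
  then have "abs_convergent_prod (\<lambda>j. 1 - a * q ^ j)"
    by (simp add: summable_imp_abs_convergent_prod)
  then show ?thesis
    by (rule abs_convergent_prod_imp_convergent_prod)
qed

lemma qpn_tendsto:
  assumes "norm q < 1"
  shows "qpn a q \<longlonglongrightarrow> qpoch_inf a q"
proof -
  have "(\<lambda>n. \<Prod>j\<le>n. 1 - a * q ^ j) \<longlonglongrightarrow> qpoch_inf a q"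
    unfolding qpoch_inf_def using convergent_prod_qpoch[OF assms] by (rule convergent_prod_LIMSEQ)
  then have "(\<lambda>n. qpn a q (Suc n)) \<longlonglongrightarrow> qpoch_inf a q"
    by (simp add: qpn_def lessThan_Suc_atMost)
  then show ?thesis by (rule LIMSEQ_imp_Suc)
qed

lemma qpoch_inf_nonzero:
  assumes "norm q < 1" "\<And>j. a * q ^ j \<noteq> 1"
  shows "qpoch_inf a q \<noteq> 0"
  unfolding qpoch_inf_def
  using convergent_prod_qpoch[OF assms(1)] assms(2) by (intro prodinf_nonzero) auto

lemma qpoch_inf_split:
  assumes "norm q < 1"
  shows "qpoch_inf a q = qpn a q m * qpoch_inf (a * q ^ m) q"
proof (rule LIMSEQ_unique)
  show "(\<lambda>k. qpn a q (k + m)) \<longlonglongrightarrow> qpoch_inf a q"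
    by (intro LIMSEQ_ignore_initial_segment qpn_tendsto assms)
  show "(\<lambda>k. qpn a q (k + m)) \<longlonglongrightarrow> qpn a q m * qpoch_inf (a * q ^ m) q"
    unfolding add.commute[of _ m] qpn_add by (intro tendsto_intros qpn_tendsto assms)
qed

lemma qpn_bounded:
  assumes "norm q < 1"
  obtains M where "M > 0" "\<And>n. norm (qpn a q n) \<le> M"
proof -
  have "Bseq (qpn a q)"
    using qpn_tendsto[OF assms] by (intro convergent_imp_Bseq) (auto simp: convergent_def)
  then show ?thesis using that by (auto elim: BseqE)
qed

text \<open>The finite products have a non-zero limit, so their inverses converge too.\<close>

lemma inverse_qpn_bounded:
  assumes "norm q < 1" "\<And>j. a * q ^ j \<noteq> 1"
  obtains M where "M > 0" "\<And>n. norm (inverse (qpn a q n)) \<le> M"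
proof -
  have "(\<lambda>n. inverse (qpn a q n)) \<longlonglongrightarrow> inverse (qpoch_inf a q)"
    by (intro tendsto_inverse qpn_tendsto qpoch_inf_nonzero assms)
  then have "Bseq (\<lambda>n. inverse (qpn a q n))"
    by (intro convergent_imp_Bseq) (auto simp: convergent_def)
  then show ?thesis using that by (auto elim: BseqE)
qed

lemma mult_power_neq_1:
  fixes a q :: complex
  assumes "norm a < 1" "norm q < 1"
  shows "a * q ^ j \<noteq> 1"
proof
  assume "a * q ^ j = 1"
  moreover have "norm (a * q ^ j) \<le> norm a * 1"
    unfolding norm_mult norm_power using assms by (intro mult_left_mono power_le_one) auto
  ultimately show False using assms by simp
qed

section \<open>The q-Gauss sum\<close>

text \<open>Summand of the basic hypergeometric series 2phi1(a, b; c; q, c/(ab)).\<close>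

definition qgauss_term :: "complex \<Rightarrow> complex \<Rightarrow> complex \<Rightarrow> complex \<Rightarrow> nat \<Rightarrow> complex" where
  "qgauss_term a b c q k =
     qpn a q k * qpn b q k / (qpn q q k * qpn c q k) * (c / (a * b)) ^ k"

text \<open>The constant must not depend on \<open>N\<close>, since \<open>q_gauss\<close> lets
  \<open>N\<close> tend to infinity. Uniformity comes from writing 1/(c q^N)_k as (c)_N / (c)_(N+k),
  which needs bounds for the parameter c only.\<close>

lemma qgauss_term_bound:
  assumes q: "norm q < 1" and c: "\<And>j. c * q ^ j \<noteq> 1"
  obtains M where "M > 0"
    "\<And>N k. norm (qgauss_term a b (c * q ^ N) q k) \<le> M * (norm (c / (a * b)) * norm q ^ N) ^ k"
proof -
  obtain A where A: "A > 0" "\<And>n. norm (qpn a q n) \<le> A" using qpn_bounded[OF q] by blast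
  obtain B where B: "B > 0" "\<And>n. norm (qpn b q n) \<le> B" using qpn_bounded[OF q] by blast
  obtain Q where Q: "Q > 0" "\<And>n. norm (inverse (qpn q q n)) \<le> Q"
    using inverse_qpn_bounded[OF q mult_power_neq_1[OF q q]] by blast
  obtain C where C: "C > 0" "\<And>n. norm (qpn c q n) \<le> C" using qpn_bounded[OF q] by blast
  obtain D where D: "D > 0" "\<And>n. norm (inverse (qpn c q n)) \<le> D"
    using inverse_qpn_bounded[OF q c] by blast
  show ?thesis
  proof (rule that)
    show "A * B * (Q * (C * D)) > 0" using A B Q C D by simp
  next
    fix N k
    have nz: "qpn c q N \<noteq> 0" using c by (auto simp: qpn_eq_0_iff)
    have "qgauss_term a b (c * q ^ N) q k
        = qpn a q k * qpn b q k * (inverse (qpn q q k) * (qpn c q N * inverse (qpn c q (N + k))))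
          * (c * q ^ N / (a * b)) ^ k"
      using nz unfolding qgauss_term_def by (simp add: qpn_add field_simps)
    then have "norm (qgauss_term a b (c * q ^ N) q k) =
        norm (qpn a q k) * norm (qpn b q k) * (norm (inverse (qpn q q k)) *
          (norm (qpn c q N) * norm (inverse (qpn c q (N + k)))))
          * (norm (c / (a * b)) * norm q ^ N) ^ k"
      by (simp only: norm_mult norm_power norm_divide) (simp add: field_simps)
    also have "\<dots> \<le> A * B * (Q * (C * D)) * (norm (c / (a * b)) * norm q ^ N) ^ k"
      using A B Q C D by (intro mult_right_mono mult_mono) (auto intro: less_imp_le mult_nonneg_nonneg)
    finally show "norm (qgauss_term a b (c * q ^ N) q k)
        \<le> A * B * (Q * (C * D)) * (norm (c / (a * b)) * norm q ^ N) ^ k" .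
  qed
qed

lemma qgauss_abs_summable:
  assumes q: "norm q < 1" and c: "\<And>j. c * q ^ j \<noteq> 1" and "norm (c / (a * b)) < 1"
  shows "summable (\<lambda>k. norm (qgauss_term a b c q k))"
proof -
  obtain M where M: "M > 0" "\<And>N k. norm (qgauss_term a b (c * q ^ N) q k)
      \<le> M * (norm (c / (a * b)) * norm q ^ N) ^ k"
    using qgauss_term_bound[OF q c] by blast
  show ?thesis
  proof (rule summable_comparison_test')
    show "summable (\<lambda>k. M * norm (c / (a * b)) ^ k)"
      using assms by (intro summable_mult summable_geometric) auto
    show "norm (norm (qgauss_term a b c q k)) \<le> M * norm (c / (a * b)) ^ k" for k
      using M(2)[of 0 k] by simp
  qed
qed

text \<open>The difference telescopes, with certificate \<open>- (1 - c) (1 - q\<^sup>k) t\<^sub>k\<close>.\<close>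

lemma qgauss_contiguous:
  assumes q: "norm q < 1" and c: "\<And>j. c * q ^ j \<noteq> 1" and ab: "a \<noteq> 0" "b \<noteq> 0"
    and lt: "norm (c / (a * b)) < 1"
  shows "(1 - c) * (1 - c / (a * b)) * (\<Sum>k. qgauss_term a b c q k)
    = (1 - c / a) * (1 - c / b) * (\<Sum>k. qgauss_term a b (c * q) q k)"
proof -
  let ?t = "qgauss_term a b c q" and ?s = "qgauss_term a b (c * q) q"
  define U where "U k = - (1 - c) * (1 - q ^ k) * ?t k" for k
  have c1: "1 - c \<noteq> 0" using c[of 0] by simp
  have cq: "c * q * q ^ j \<noteq> 1" for j using c[of "Suc j"] by (simp add: mult.assoc)
  have ltq: "norm (c * q / (a * b)) < 1"
  proof -
    have "norm (c * q / (a * b)) = norm (c / (a * b)) * norm q"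
      by (simp add: norm_mult norm_divide)
    also have "\<dots> \<le> norm (c / (a * b)) * 1" using q by (intro mult_left_mono) auto
    finally show ?thesis using lt by simp
  qed
  have t: "summable ?t" and s: "summable ?s"
    using qgauss_abs_summable[OF q c lt] qgauss_abs_summable[OF q cq ltq]
    by (auto intro: summable_norm_cancel)
  have step: "(1 - c) * (1 - c / (a * b)) * ?t k - (1 - c / a) * (1 - c / b) * ?s k
      = U (Suc k) - U k" for k
  proof -
    define Q where "Q = q ^ k"
    have n1: "1 - q * Q \<noteq> 0" "1 - c * Q \<noteq> 0"
      using mult_power_neq_1[OF q q, of k] c[of k] by (auto simp: Q_def)
    have "(1 - c) * qpn (c * q) q k = qpn c q k * (1 - c * Q)"
      unfolding Q_def qpn_Suc[symmetric] qpn_Suc'[symmetric] ..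
    then have e: "qpn (c * q) q k = qpn c q k * (1 - c * Q) / (1 - c)"
      using c1 by (simp add: field_simps)
    have "c * q / (a * b) = q * (c / (a * b))" by simp
    then have pw: "(c * q / (a * b)) ^ k = Q * (c / (a * b)) ^ k"
      unfolding Q_def by (metis power_mult_distrib)
    have s': "?s k = ?t k * (Q * (1 - c) / (1 - c * Q))"
      unfolding qgauss_term_def e pw by (simp add: mult_ac)
    have t': "?t (Suc k) = ?t k * ((1 - a * Q) * (1 - b * Q) / ((1 - q * Q) * (1 - c * Q)) * (c / (a * b)))"
      unfolding qgauss_term_def qpn_Suc Q_def by (simp add: mult_ac)
    \<comment> \<open>Both \<open>?s k\<close> and \<open>?t (Suc k)\<close> are rational multiples
      of \<open>?t k\<close>, so what remains is an identity of rational functions in a, b, c and Q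
      = q^k.\<close>
    have "(1 - c) * (1 - c / (a * b)) - (1 - c / a) * (1 - c / b) * (Q * (1 - c) / (1 - c * Q))
      = - (1 - c) * (1 - q * Q) * ((1 - a * Q) * (1 - b * Q) / ((1 - q * Q) * (1 - c * Q)) * (c / (a * b)))
        + (1 - c) * (1 - Q)" (is "?l = ?r")
      using n1 ab by (simp add: divide_simps) algebra
    then have *: "?t k * ?l = ?t k * ?r" by simp
    \<comment> \<open>Regrouping is done once for opaque variables, so that the fractions are not
      multiplied out.\<close>
    have "T * (A - B * S) = T * (- C * E * W + C * D) \<Longrightarrow>
        A * T - B * (T * S) = - C * E * (T * W) - - C * D * T" for T A B C D E S W :: complex
      by (simp add: algebra_simps)
    from this[OF *] show ?thesis
      unfolding U_def s' t' power_Suc Q_def[symmetric] .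
  qed
  \<comment> \<open>U tends to 0 because the terms of a convergent series do, and
    \<open>U 0 = 0\<close> by the factor 1 - q^0. The telescoped sum is therefore 0.\<close>
  have "U \<longlonglongrightarrow> - (1 - c) * (1 - 0) * 0"
    unfolding U_def by (intro tendsto_intros LIMSEQ_power_zero q summable_LIMSEQ_zero t)
  then have "U \<longlonglongrightarrow> 0" by simp
  then have "(\<lambda>k. U (Suc k) - U k) sums (0 - U 0)" by (rule telescope_sums)
  moreover have "U 0 = 0" by (simp add: U_def)
  moreover have "(\<lambda>k. (1 - c) * (1 - c / (a * b)) * ?t k - (1 - c / a) * (1 - c / b) * ?s k)
      sums ((1 - c) * (1 - c / (a * b)) * suminf ?t - (1 - c / a) * (1 - c / b) * suminf ?s)"
    by (intro sums_diff sums_mult summable_sums t s)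
  ultimately show ?thesis
    unfolding step using sums_unique2 by fastforce
qed

text \<open>N contiguous steps move c to c q^N. As N grows, the series at c q^N tends to its first
  term 1 and the finite products tend to the infinite ones.\<close>

theorem q_gauss:
  assumes q: "norm q < 1" and c: "\<And>j. c * q ^ j \<noteq> 1" and ab: "a \<noteq> 0" "b \<noteq> 0"
    and lt: "norm (c / (a * b)) < 1"
  shows "qgauss_term a b c q sums
    (qpoch_inf (c / a) q * qpoch_inf (c / b) q / (qpoch_inf c q * qpoch_inf (c / (a * b)) q))"
proof -
  define S where "S N = (\<Sum>k. qgauss_term a b (c * q ^ N) q k)" for N
  define r where "r = norm (c / (a * b))"
  have cN: "c * q ^ N * q ^ j \<noteq> 1" for N j
    using c[of "N + j"] by (simp add: power_add mult.assoc)
  have r: "0 \<le> r" "r < 1" using lt by (auto simp: r_def)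
  have qN: "norm q ^ N \<le> 1" for N using q by (intro power_le_one) auto
  have nrm: "norm (c * q ^ N / (a * b)) = r * norm q ^ N" for N
    by (simp add: r_def norm_mult norm_divide norm_power)
  have ltN: "norm (c * q ^ N / (a * b)) < 1" for N
    using mult_left_mono[OF qN[of N] r(1)] r nrm[of N] by simp
  have summ: "summable (\<lambda>k. norm (qgauss_term a b (c * q ^ N) q k))" for N
    by (rule qgauss_abs_summable[OF q cN ltN])
  \<comment> \<open>No division here: (c/a)_N and (c/b)_N may vanish.\<close>
  have iter: "qpn c q N * qpn (c / (a * b)) q N * S 0 = qpn (c / a) q N * qpn (c / b) q N * S N" for N
  proof (induction N)
    case (Suc N)
    have st: "(1 - c * q ^ N) * (1 - c * q ^ N / (a * b)) * S N
      = (1 - c * q ^ N / a) * (1 - c * q ^ N / b) * S (Suc N)"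
      using qgauss_contiguous[OF q cN ab ltN] by (simp add: S_def mult_ac)
    have "qpn c q (Suc N) * qpn (c / (a * b)) q (Suc N) * S 0
        = (qpn c q N * qpn (c / (a * b)) q N * S 0) * ((1 - c * q ^ N) * (1 - c * q ^ N / (a * b)))"
      by (simp add: qpn_Suc)
    also have "\<dots> = qpn (c / a) q N * qpn (c / b) q N * ((1 - c * q ^ N) * (1 - c * q ^ N / (a * b)) * S N)"
      unfolding Suc.IH by simp
    also have "\<dots> = qpn (c / a) q (Suc N) * qpn (c / b) q (Suc N) * S (Suc N)"
      unfolding st by (simp add: qpn_Suc)
    finally show ?case .
  qed simp
  obtain M where M: "M > 0" "\<And>N k. norm (qgauss_term a b (c * q ^ N) q k) \<le> M * (r * norm q ^ N) ^ k"
    using qgauss_term_bound[OF q c] unfolding r_def by blast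
  \<comment> \<open>The term k = 0 equals 1, and the bound for every later term contains at least
    one factor |q|^N; a geometric series controls the rest.\<close>
  have "norm (S N - 1) \<le> norm q ^ N * (M / (1 - r))" for N
  proof -
    have "S N = qgauss_term a b (c * q ^ N) q 0 + (\<Sum>k. qgauss_term a b (c * q ^ N) q (Suc k))"
      unfolding S_def using suminf_split_head[OF summable_norm_cancel[OF summ[of N]]] by simp
    then have e: "S N - 1 = (\<Sum>k. qgauss_term a b (c * q ^ N) q (Suc k))"
      by (simp add: qgauss_term_def)
    have bd: "norm (qgauss_term a b (c * q ^ N) q (Suc k)) \<le> norm q ^ N * M * r ^ k" for k
    proof -
      have "(r * norm q ^ N) ^ Suc k = norm q ^ N * (r ^ k * (r * (norm q ^ N) ^ k))"
        by (simp add: power_mult_distrib)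
      also have "\<dots> \<le> norm q ^ N * (r ^ k * (1 * 1))"
        using r qN q by (intro mult_left_mono mult_mono power_le_one) auto
      finally have "M * (r * norm q ^ N) ^ Suc k \<le> M * (norm q ^ N * r ^ k)"
        using M(1) by (intro mult_left_mono) auto
      then show ?thesis using M(2)[of N "Suc k"] by (simp add: mult_ac)
    qed
    have geo: "(\<lambda>k. norm q ^ N * M * r ^ k) sums (norm q ^ N * M * (1 / (1 - r)))"
      using r by (intro sums_mult geometric_sums) auto
    have "norm (\<Sum>k. qgauss_term a b (c * q ^ N) q (Suc k)) \<le> (\<Sum>k. norm q ^ N * M * r ^ k)"
      using bd sums_summable[OF geo] by (rule norm_suminf_le)
    then show ?thesis using e sums_unique[OF geo] by simp
  qed
  moreover have "(\<lambda>N. norm q ^ N * (M / (1 - r))) \<longlonglongrightarrow> 0 * (M / (1 - r))"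
    using q by (intro tendsto_intros LIMSEQ_power_zero) auto
  ultimately have "(\<lambda>N. S N - 1) \<longlonglongrightarrow> 0"
    by (intro Lim_null_comparison[of "\<lambda>N. S N - 1"]) auto
  then have S1: "S \<longlonglongrightarrow> 1" by (simp add: LIM_zero_iff)
  have "qpoch_inf c q * qpoch_inf (c / (a * b)) q * S 0 = qpoch_inf (c / a) q * qpoch_inf (c / b) q * 1"
  proof (rule LIMSEQ_unique)
    show "(\<lambda>N. qpn c q N * qpn (c / (a * b)) q N * S 0)
        \<longlonglongrightarrow> qpoch_inf c q * qpoch_inf (c / (a * b)) q * S 0"
      by (intro tendsto_intros qpn_tendsto q)
    show "(\<lambda>N. qpn c q N * qpn (c / (a * b)) q N * S 0)
        \<longlonglongrightarrow> qpoch_inf (c / a) q * qpoch_inf (c / b) q * 1"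
      unfolding iter by (intro tendsto_intros qpn_tendsto q S1)
  qed
  moreover have "qpoch_inf c q \<noteq> 0" "qpoch_inf (c / (a * b)) q \<noteq> 0"
    using qpoch_inf_nonzero[OF q c] qpoch_inf_nonzero[OF q mult_power_neq_1[OF lt q]] by auto
  ultimately have "S 0 = qpoch_inf (c / a) q * qpoch_inf (c / b) q / (qpoch_inf c q * qpoch_inf (c / (a * b)) q)"
    by (simp add: field_simps)
  then show ?thesis
    using summable_sums[OF summable_norm_cancel[OF summ[of 0]]] by (simp add: S_def)
qed

section \<open>Finite q-binomial theorem and finite Jacobi triple product\<close>

text \<open>The usual statement divided by (q)_N, so that Gaussian binomials become 1/((q)_k
  (q)_(N-k)). The induction is the q-Pascal rule.\<close>

lemma finite_q_binomial_theorem: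
  fixes q t :: complex
  assumes q: "norm q < 1"
  shows "(\<Sum>k\<le>N. q ^ (k choose 2) * t ^ k / (qpn q q k * qpn q q (N - k)))
    = qpn (- t) q N / qpn q q N"
proof (induction N)
  case (Suc N)
  define f where "f N k = q ^ (k choose 2) * t ^ k / (qpn q q k * qpn q q (N - k))" for N k
  have nz: "1 - q * q ^ j \<noteq> 0" for j using mult_power_neq_1[OF q q, of j] by simp
  have nz': "qpn q q j \<noteq> 0" for j using mult_power_neq_1[OF q q] by (simp add: qpn_eq_0_iff)
  \<comment> \<open>The conditionals supply the zeros of \<open>f N\<close> outside 0 \<le> k \<le>
    N; truncated subtraction would give non-zero values there.\<close>
  have pascal: "(1 - q * q ^ N) * f (Suc N) k
    = (if k \<le> N then f N k else 0) + (if k = 0 then 0 else t * q ^ N * f N (k - 1))"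
    if "k \<le> Suc N" for k
  proof -
    consider "k = 0" | "k = Suc N" | j i where "k = Suc j" "N = Suc (j + i)"
      using \<open>k \<le> Suc N\<close> by (metis le_SucE less_iff_Suc_add not0_implies_Suc Suc_le_eq)
    then show ?thesis
    proof cases
      case 1
      then show ?thesis using nz nz' by (simp add: f_def qpn_Suc field_simps)
    next
      case 2
      then show ?thesis using nz nz'
        by (simp add: f_def qpn_Suc numeral_2_eq_2 power_add field_simps)
    next
      case 3
      have "Suc N - k = Suc i" "N - k = i" "N - (k - 1) = Suc i" using 3 by auto
      then show ?thesis using nz nz' 3 nz[of i] nz[of j]
        by (simp add: f_def qpn_Suc numeral_2_eq_2 power_add divide_simps) (simp add: algebra_simps)
    qed
  qed
  have "(1 - q * q ^ N) * (\<Sum>k\<le>Suc N. f (Suc N) k)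
     = (\<Sum>k\<le>Suc N. (if k \<le> N then f N k else 0) + (if k = 0 then 0 else t * q ^ N * f N (k - 1)))"
    unfolding sum_distrib_left by (intro sum.cong refl pascal) simp
  also have "\<dots> = (\<Sum>k\<le>N. f N k) + t * q ^ N * (\<Sum>k\<le>N. f N k)"
    by (simp only: sum.distrib, subst (2) sum.atMost_Suc_shift) (simp add: sum_distrib_left)
  also have "\<dots> = (1 + t * q ^ N) * (qpn (- t) q N / qpn q q N)"
    using Suc.IH unfolding f_def by (simp only:) (simp add: algebra_simps add_divide_distrib)
  finally have "(\<Sum>k\<le>Suc N. f (Suc N) k) = (1 + t * q ^ N) * (qpn (- t) q N / qpn q q N) / (1 - q * q ^ N)"
    using nz[of N] by (metis nonzero_mult_div_cancel_left)
  then show ?case by (simp add: f_def qpn_Suc mult_ac)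
qed (simp add: numeral_2_eq_2)

lemma int_choose_2: "2 * int (k choose 2) = int k * (int k - 1)"
  by (induction k) (simp_all add: numeral_2_eq_2 algebra_simps)

text \<open>This is the q-binomial theorem with N = 2n and t = w/q^n, with the summation index
  centred by k = r + n. \<open>K\<close> collects the factors independent of k.\<close>

lemma finite_jacobi_triple_product:
  fixes q w :: complex
  assumes q: "norm q < 1" "q \<noteq> 0" and w: "w \<noteq> 0"
  shows "(\<Sum>r=-int n..int n. q powi (r * (r - 1) div 2) * w powi r
       / (qpn q q (nat (int n - r)) * qpn q q (nat (int n + r))))
    = qpn (- w) q n * qpn (- (q / w)) q n / qpn q q (2 * n)"
proof -
  define K where "K = q ^ (Suc n choose 2) / w ^ n"
  define t where "t = w / q ^ n"
  have K: "q powi (r * (r - 1) div 2) * w powi r = K * (q ^ (k choose 2) * t ^ k)"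
    if r: "r = int k - int n" for r k
  proof -
    \<comment> \<open>Doubling removes \<open>div\<close>, as r(r - 1) is even.\<close>
    have "2 * (r * (r - 1) div 2) = r * (r - 1)" by simp
    also have "\<dots> = 2 * (int (k choose 2) + int (Suc n choose 2) - int (n * k))"
      using int_choose_2[of k] int_choose_2[of "Suc n"] unfolding r by (simp add: algebra_simps)
    finally have "r * (r - 1) div 2 = int (k choose 2) + int (Suc n choose 2) - int (n * k)" by simp
    then have "q powi (r * (r - 1) div 2) = q ^ (k choose 2) * q ^ (Suc n choose 2) / (q ^ n) ^ k"
      using q by (simp only: power_int_diff power_int_add power_int_of_nat power_mult simp_thms)
    moreover have "w powi r = w ^ k / w ^ n"
      using w unfolding r by (simp add: power_int_diff)
    ultimately show ?thesis by (simp add: K_def t_def power_divide mult_ac)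
  qed
  \<comment> \<open>Multiplying 1 + w q^(-j) by q^j / w gives 1 + q^j / w. Over j = 1..m the
    multipliers have product q^(m(m+1)/2) / w^m, which is \<open>K\<close> when m = n.\<close>
  have low: "q ^ (Suc m choose 2) / w ^ m * qpn (- (w / q ^ m)) q m = qpn (- (q / w)) q m" for m
  proof (induction m)
    case (Suc m)
    have "qpn (- (w / q ^ Suc m)) q (Suc m) = (1 + w / q ^ Suc m) * qpn (- (w / q ^ m)) q m"
      using q by (simp add: qpn_Suc')
    moreover have "q ^ (Suc (Suc m) choose 2) / w ^ Suc m
        = q ^ (Suc m choose 2) / w ^ m * (q ^ Suc m / w)"
      by (simp add: numeral_2_eq_2 power_add mult_ac)
    ultimately have "q ^ (Suc (Suc m) choose 2) / w ^ Suc m * qpn (- (w / q ^ Suc m)) q (Suc m)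
        = (q ^ (Suc m choose 2) / w ^ m * qpn (- (w / q ^ m)) q m) * (q ^ Suc m / w * (1 + w / q ^ Suc m))"
      by (simp only: mult_ac)
    also have "q ^ Suc m / w * (1 + w / q ^ Suc m) = 1 + q / w * q ^ m"
      using q w by (simp add: field_simps)
    finally show ?case unfolding Suc.IH by (simp add: qpn_Suc)
  qed (simp add: numeral_2_eq_2)
  have "(\<Sum>r=-int n..int n. q powi (r * (r - 1) div 2) * w powi r
       / (qpn q q (nat (int n - r)) * qpn q q (nat (int n + r))))
    = (\<Sum>k\<le>2 * n. K * (q ^ (k choose 2) * t ^ k / (qpn q q k * qpn q q (2 * n - k))))"
  proof (rule sum.reindex_bij_witness[of _ "\<lambda>k. int k - int n" "\<lambda>r. nat (r + int n)"])
    fix r assume r: "r \<in> {- int n..int n}"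
    have "K * (q ^ (nat (r + int n) choose 2) * t ^ nat (r + int n))
        = q powi (r * (r - 1) div 2) * w powi r"
      using r by (intro K[symmetric]) auto
    moreover have "2 * n - nat (r + int n) = nat (int n - r)" using r by auto
    ultimately show "K * (q ^ (nat (r + int n) choose 2) * t ^ nat (r + int n)
        / (qpn q q (nat (r + int n)) * qpn q q (2 * n - nat (r + int n))))
      = q powi (r * (r - 1) div 2) * w powi r
        / (qpn q q (nat (int n - r)) * qpn q q (nat (int n + r)))"
      by (simp add: add.commute mult.commute)
  qed auto
  also have "\<dots> = K * (qpn (- t) q (2 * n) / qpn q q (2 * n))"
    unfolding sum_distrib_left[symmetric] finite_q_binomial_theorem[OF q(1)] ..
  also have "qpn (- t) q (2 * n) = qpn (- t) q n * qpn (- w) q n"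
    unfolding mult_2 qpn_add using q by (simp add: t_def)
  also have "K * (qpn (- t) q n * qpn (- w) q n / qpn q q (2 * n))
      = (K * qpn (- t) q n) * qpn (- w) q n / qpn q q (2 * n)" by simp
  also have "K * qpn (- t) q n = qpn (- (q / w)) q n"
    unfolding K_def t_def by (rule low)
  finally show ?thesis by (simp add: mult.commute)
qed

section \<open>The Bailey pair\<close>

definition theta_coeff :: "complex \<Rightarrow> complex \<Rightarrow> complex \<Rightarrow> int \<Rightarrow> complex" where
  "theta_coeff q b z r = q powi (r * (r - 1) div 2) * (1 / z) powi r
     * ((1 - b * q powi r) - z * (q powi r - b))"

text \<open>Since (1 - b q^r) - z(q^r - b) = (1 + bz) - (b + z) q^r, the coefficient splits into two
  pure theta terms, and the triple product applies to each with w = 1/z and w = q/z.\<close>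

lemma theta_coeff_eq:
  assumes "q \<noteq> 0"
  shows "theta_coeff q b z r = (1 + b * z) * (q powi (r * (r - 1) div 2) * (1 / z) powi r)
    - (b + z) * (q powi (r * (r - 1) div 2) * (q / z) powi r)"
proof -
  have "(q / z) powi r = q powi r * (1 / z) powi r"
    by (simp add: power_int_mult_distrib[symmetric])
  then show ?thesis unfolding theta_coeff_def by (simp add: algebra_simps)
qed

text \<open>Up to the factor \<open>1 - z\<close> this is a Bailey pair relative to \<open>a = 1\<close>.\<close>

lemma theta_bailey_pair:
  assumes q: "norm q < 1" "q \<noteq> 0" and z: "z \<noteq> 0"
  shows "(\<Sum>r=-int n..int n. theta_coeff q b z r
       / (qpn q q (nat (int n - r)) * qpn q q (nat (int n + r))))
    = (1 - z) * (1 - b * q ^ n) * qpn (- 1 / z) q n * qpn (- z) q n / qpn q q (2 * n)"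
proof -
  define X where "X = qpn (- 1 / z) q n"
  define X' where "X' = qpn (- (q / z)) q n"
  define P where "P = qpn (- z) q n"
  define P' where "P' = qpn (- (z * q)) q n"
  define Q where "Q = q ^ n"
  have F1: "(\<Sum>r=-int n..int n. q powi (r * (r - 1) div 2) * (1 / z) powi r
       / (qpn q q (nat (int n - r)) * qpn q q (nat (int n + r)))) = X * P' / qpn q q (2 * n)"
    using finite_jacobi_triple_product[OF q, of "1 / z" n] z by (simp add: X_def P'_def mult.commute)
  have F2: "(\<Sum>r=-int n..int n. q powi (r * (r - 1) div 2) * (q / z) powi r
       / (qpn q q (nat (int n - r)) * qpn q q (nat (int n + r)))) = X' * P / qpn q q (2 * n)"
    using finite_jacobi_triple_product[OF q, of "q / z" n] z q by (simp add: X'_def P_def)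
  have "(\<Sum>r=-int n..int n. theta_coeff q b z r
       / (qpn q q (nat (int n - r)) * qpn q q (nat (int n + r))))
    = (1 + b * z) * (X * P' / qpn q q (2 * n)) - (b + z) * (X' * P / qpn q q (2 * n))"
    unfolding theta_coeff_eq[OF q(2)] F1[symmetric] F2[symmetric] sum_distrib_left
      sum_subtractf[symmetric]
    by (intro sum.cong refl) (simp add: diff_divide_distrib)
  also have "\<dots> = ((1 + b * z) * X * P' - (b + z) * X' * P) / qpn q q (2 * n)"
    by (simp add: diff_divide_distrib mult.assoc)
  also have "(1 + b * z) * X * P' - (b + z) * X' * P = (1 - z) * (1 - b * Q) * X * P"
  \<comment> \<open>The general case cancels a factor 1 + z. At z = -1 both products
    \<open>X\<close> and \<open>P\<close> contain a zero factor as soon as n > 0.\<close>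
  proof (cases "z = -1")
    case True
    show ?thesis
    proof (cases n)
      case 0
      then show ?thesis using True by (simp add: X_def X'_def P_def P'_def Q_def)
    next
      case (Suc m)
      have "X = 0" "P = 0" using True Suc by (simp_all add: X_def P_def qpn_Suc')
      then show ?thesis by simp
    qed
  next
    case False
    \<comment> \<open>Splitting off the first or the last factor of (-z)_(n+1) gives the same
      product; likewise for (-1/z)_(n+1) below.\<close>
    have "(1 + z) * P' = P * (1 + z * Q)"
      using qpn_Suc[of "-z" q n] qpn_Suc'[of "-z" q n] by (simp add: P_def P'_def Q_def)
    moreover have "(1 + 1 / z) * X' = X * (1 + Q / z)"
      using qpn_Suc[of "-1/z" q n] qpn_Suc'[of "-1/z" q n] by (simp add: X_def X'_def Q_def)
    then have "(1 + z) * X' = X * (z + Q)"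
      using z by (simp add: field_simps)
    ultimately have "(1 + z) * ((1 + b * z) * X * P' - (b + z) * X' * P)
        = (1 + z) * ((1 - z) * (1 - b * Q) * X * P)"
      by algebra
    moreover have "1 + z \<noteq> 0" using False by (metis add.commute eq_neg_iff_add_eq_0)
    ultimately show ?thesis by simp
  qed
  finally show ?thesis by (simp add: X_def P_def Q_def)
qed

section \<open>Absolute convergence of theta series\<close>

text \<open>Ratio test: consecutive norms have quotient |q|^n |w|, which tends to 0; 1/2 is an
  arbitrary bound below 1.\<close>

lemma summable_q_square:
  fixes q w :: complex
  assumes "norm q < 1"
  shows "summable (\<lambda>n. norm (q ^ (n choose 2) * w ^ n))"
proof -
  have "(\<lambda>n. norm q ^ n * norm w) \<longlonglongrightarrow> 0 * norm w"
    using assms by (intro tendsto_intros LIMSEQ_power_zero) auto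
  then have "eventually (\<lambda>n. norm q ^ n * norm w < 1 / 2) sequentially"
    by (rule order_tendstoD) simp
  then obtain N where N: "\<And>n. n \<ge> N \<Longrightarrow> norm q ^ n * norm w < 1 / 2"
    by (auto simp: eventually_sequentially)
  show ?thesis
  proof (rule summable_ratio_test[of "1/2" N])
    fix n assume "n \<ge> N"
    have "norm (q ^ (Suc n choose 2) * w ^ Suc n)
        = (norm q ^ n * norm w) * norm (q ^ (n choose 2) * w ^ n)"
      by (simp add: numeral_2_eq_2 power_add norm_mult norm_power)
    also have "\<dots> \<le> 1 / 2 * norm (q ^ (n choose 2) * w ^ n)"
      using N[OF \<open>n \<ge> N\<close>] by (intro mult_right_mono) auto
    finally show "norm (norm (q ^ (Suc n choose 2) * w ^ Suc n))
        \<le> 1 / 2 * norm (norm (q ^ (n choose 2) * w ^ n))" by simp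
  qed simp
qed

text \<open>At r = -n the exponent r(r - 1)/2 is (n choose 2) + n, so the negative half is the
  positive half with q/w in place of w.\<close>

lemma theta_abs_summable:
  fixes q w :: complex
  assumes q: "norm q < 1" "q \<noteq> 0" and w: "w \<noteq> 0"
  shows "(\<lambda>r::int. norm (q powi (r * (r - 1) div 2) * w powi r)) summable_on UNIV"
proof -
  let ?f = "\<lambda>r::int. norm (q powi (r * (r - 1) div 2) * w powi r)"
  have pos: "?f (int n) = norm (q ^ (n choose 2) * w ^ n)" for n
  proof -
    have "int n * (int n - 1) div 2 = int (n choose 2)" using int_choose_2[of n] by linarith
    then show ?thesis by simp
  qed
  have neg: "?f (- int n) = norm (q ^ (n choose 2) * (q / w) ^ n)" for n
  proof -
    have "2 * (- int n * (- int n - 1) div 2) = - int n * (- int n - 1)" by simp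
    also have "\<dots> = 2 * (int (n choose 2) + int n)"
      using int_choose_2[of n] by (simp add: algebra_simps)
    finally have "- int n * (- int n - 1) div 2 = int (n choose 2) + int n" by simp
    then show ?thesis using q w
      by (simp add: power_int_add power_int_minus power_mult_distrib power_inverse divide_inverse mult.assoc)
  qed
  have inj_neg: "inj (\<lambda>n. - int n)" by (simp add: inj_def)
  have "?f summable_on range int" "?f summable_on range (\<lambda>n. - int n)"
    unfolding summable_on_reindex[OF inj_of_nat] summable_on_reindex[OF inj_neg] o_def pos neg
    by (intro summable_nonneg_imp_summable_on summable_q_square q norm_ge_zero)+
  then have "?f summable_on (range int \<union> range (\<lambda>n. - int n))"
    by (rule summable_on_union)
  also have "range int \<union> range (\<lambda>n. - int n) = UNIV"
    by (auto simp: image_iff) (metis int_cases2)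
  finally show ?thesis .
qed

lemma theta_coeff_abs_summable:
  assumes q: "norm q < 1" "q \<noteq> 0" and z: "z \<noteq> 0"
  shows "(\<lambda>r. norm (theta_coeff q b z r)) summable_on UNIV"
proof (rule Infinite_Sum.abs_summable_on_comparison_test')
  let ?f = "\<lambda>w (r::int). norm (q powi (r * (r - 1) div 2) * w powi r)"
  show "(\<lambda>r. norm (1 + b * z) * ?f (1 / z) r + norm (b + z) * ?f (q / z) r) summable_on UNIV"
    using q z by (intro summable_on_add summable_on_cmult_right theta_abs_summable) auto
  show "norm (theta_coeff q b z r)
      \<le> norm (1 + b * z) * ?f (1 / z) r + norm (b + z) * ?f (q / z) r" for r
    unfolding theta_coeff_eq[OF q(2)] norm_mult[symmetric] by (rule norm_triangle_ineq4)
qed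

section \<open>Evaluation of the inner sum\<close>

text \<open>The kernel of Bailey's lemma for a = 1. The case m > n encodes 1/(q)_(n-m) = 0, which
  the truncated \<open>n - m\<close> would miss.\<close>

definition bailey_kernel :: "complex \<Rightarrow> nat \<Rightarrow> nat \<Rightarrow> complex" where
  "bailey_kernel q m n = (if m \<le> n then 1 / (qpn q q (n - m) * qpn q q (n + m)) else 0)"

text \<open>With n = k + m the series becomes a q-Gauss sum with parameters x q^m, y q^m and
  q^(2m+1), whose argument c/(ab) = q/(xy) does not depend on m.\<close>

lemma bailey_kernel_sums:
  assumes q: "norm q < 1" "q \<noteq> 0" and xy: "x \<noteq> 0" "y \<noteq> 0"
    and lt: "norm (q / (x * y)) < 1"
    and xq: "\<And>j. q / x * q ^ j \<noteq> 1" and yq: "\<And>j. q / y * q ^ j \<noteq> 1"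
  shows "(\<lambda>n. qpn x q n * qpn y q n * (q / (x * y)) ^ n * bailey_kernel q m n) sums
    (qpoch_inf (q / x) q * qpoch_inf (q / y) q / (qpoch_inf q q * qpoch_inf (q / (x * y)) q)
      * (qpn x q m * qpn y q m * (q / (x * y)) ^ m / (qpn (q / x) q m * qpn (q / y) q m)))"
    (is "?f sums ?s")
proof -
  define a b c where "a = x * q ^ m" and "b = y * q ^ m" and "c = q * q ^ (2 * m)"
  \<comment> \<open>\<open>P\<close> is the term n = m, pulled out so that the q-Gauss series starts
    with 1.\<close>
  define P where "P = qpn x q m * qpn y q m * (q / (x * y)) ^ m / qpn q q (2 * m)"
  have nz: "qpn q q j \<noteq> 0" "qpn (q / x) q j \<noteq> 0" "qpn (q / y) q j \<noteq> 0" for j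
    using mult_power_neq_1[OF q(1) q(1)] xq yq by (auto simp: qpn_eq_0_iff)
  have cab: "c / (a * b) = q / (x * y)" "c / a = q / x * q ^ m" "c / b = q / y * q ^ m"
  proof -
    have "c = q * (q ^ m * q ^ m)" by (simp add: c_def mult_2 power_add)
    then show "c / (a * b) = q / (x * y)" "c / a = q / x * q ^ m" "c / b = q / y * q ^ m"
      using q xy by (simp_all add: a_def b_def)
  qed
  have c: "c * q ^ j \<noteq> 1" for j
    using mult_power_neq_1[OF q(1) q(1), of "2 * m + j"] by (simp add: c_def power_add mult.assoc)
  have "qgauss_term a b c q sums (qpoch_inf (c / a) q * qpoch_inf (c / b) q
      / (qpoch_inf c q * qpoch_inf (c / (a * b)) q))"
    using q xy lt cab(1) c by (intro q_gauss) (simp_all add: a_def b_def)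
  then have "(\<lambda>k. P * qgauss_term a b c q k) sums (P * (qpoch_inf (c / a) q * qpoch_inf (c / b) q
      / (qpoch_inf c q * qpoch_inf (c / (a * b)) q)))"
    by (rule sums_mult)
  also have "(\<lambda>k. P * qgauss_term a b c q k) = (\<lambda>k. ?f (k + m))"
  proof
    fix k
    have "qpn x q (k + m) = qpn x q m * qpn a q k" "qpn y q (k + m) = qpn y q m * qpn b q k"
      using qpn_add[of x q m k] qpn_add[of y q m k] by (simp_all add: a_def b_def add.commute)
    moreover have "qpn q q (k + m + m) = qpn q q (2 * m) * qpn c q k"
      using qpn_add[of q q "2 * m" k] by (simp add: c_def mult_2 add_ac)
    ultimately show "P * qgauss_term a b c q k = ?f (k + m)"
      by (simp add: P_def qgauss_term_def bailey_kernel_def cab(1) power_add mult_ac)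
  qed
  also have "P * (qpoch_inf (c / a) q * qpoch_inf (c / b) q
      / (qpoch_inf c q * qpoch_inf (c / (a * b)) q)) = ?s"
    unfolding cab qpoch_inf_split[OF q(1), of "q / x" m] qpoch_inf_split[OF q(1), of "q / y" m]
      qpoch_inf_split[OF q(1), of q "2 * m"] c_def[symmetric] P_def
    using nz by simp
  \<comment> \<open>The shift by m loses nothing, because the kernel vanishes for n < m.\<close>
  finally show ?thesis
    by (subst (asm) sums_zero_iff_shift) (auto simp: bailey_kernel_def)
qed

section \<open>Symmetry of the bilateral factors in the index\<close>

text \<open>Each factor on the left is a monomial times a factor on the right, and the monomials
  contribute q/x^2 per step. Zeros do no harm: 1 - x q^(-m-1) and 1 - (q/x) q^m vanish together, and
  \<open>1 / 0 = 0\<close>.\<close>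

lemma qpoch_neg_quotient:
  assumes "q \<noteq> 0" "x \<noteq> 0"
  shows "qpoch x q (- int m) / qpoch (q / x) q (- int m)
    = (q / x\<^sup>2) ^ m * (qpn x q m / qpn (q / x) q m)"
proof -
  have "(\<Prod>j=1..m. 1 - q / x * q powi (- int j)) / (\<Prod>j=1..m. 1 - x * q powi (- int j))
    = (q / x\<^sup>2) ^ m * (qpn x q m / qpn (q / x) q m)"
  proof (induction m)
    case (Suc m)
    have n: "1 - q / x * q powi (- int (Suc m)) = - (1 / (x * q ^ m)) * (1 - x * q ^ m)"
      using assms by (simp add: power_int_minus field_simps del: of_nat_Suc)
    have d: "1 - x * q powi (- int (Suc m)) = - (x / q ^ Suc m) * (1 - q / x * q ^ m)"
      using assms by (simp add: power_int_minus field_simps del: of_nat_Suc)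
    have "(\<Prod>j=1..Suc m. 1 - q / x * q powi (- int j)) / (\<Prod>j=1..Suc m. 1 - x * q powi (- int j))
      = (q / x\<^sup>2) ^ m * (qpn x q m / qpn (q / x) q m)
        * ((1 - q / x * q powi (- int (Suc m))) / (1 - x * q powi (- int (Suc m))))"
      unfolding Suc.IH[symmetric] by (simp only: times_divide_times_eq) (simp del: of_nat_Suc)
    also have "(1 - q / x * q powi (- int (Suc m))) / (1 - x * q powi (- int (Suc m)))
       = q / x\<^sup>2 * ((1 - x * q ^ m) / (1 - q / x * q ^ m))"
      unfolding n d using assms by (simp add: power2_eq_square mult_ac)
    also have "(q / x\<^sup>2) ^ m * (qpn x q m / qpn (q / x) q m) * \<dots>
      = (q / x\<^sup>2) ^ Suc m * (qpn x q (Suc m) / qpn (q / x) q (Suc m))"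
      by (simp add: qpn_Suc mult_ac)
    finally show ?case .
  qed simp
  moreover have "qpoch x q (- int m) / qpoch (q / x) q (- int m)
      = (1 / qpoch (q / x) q (- int m)) / (1 / qpoch x q (- int m))" by simp
  ultimately show ?thesis unfolding one_div_qpoch_neg by simp
qed

text \<open>For w = q/(xy) one has (q/x^2)(q/y^2) = w^2, so reflecting both quotients at r = -m
  turns w^(-m) into w^m.\<close>

lemma qpoch_quotient_symmetric:
  assumes "q \<noteq> 0" "x \<noteq> 0" "y \<noteq> 0"
  shows "qpoch x q r * qpoch y q r * (q / (x * y)) powi r / (qpoch (q / x) q r * qpoch (q / y) q r)
    = qpn x q (nat \<bar>r\<bar>) * qpn y q (nat \<bar>r\<bar>) * (q / (x * y)) ^ nat \<bar>r\<bar>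
      / (qpn (q / x) q (nat \<bar>r\<bar>) * qpn (q / y) q (nat \<bar>r\<bar>))"
proof (cases "r \<ge> 0")
  case True
  then obtain m where "r = int m" using nonneg_int_cases by blast
  then show ?thesis by (simp add: qpoch_of_nat)
next
  case False
  define m where "m = nat \<bar>r\<bar>"
  define w where "w = q / (x * y)"
  have r: "r = - int m" using False by (simp add: m_def)
  have "w \<noteq> 0" using assms by (simp add: w_def)
  have "q / x\<^sup>2 * (q / y\<^sup>2) = w * w" by (simp add: w_def power2_eq_square)
  then have "(q / x\<^sup>2) ^ m * (q / y\<^sup>2) ^ m * w powi r = w ^ m"
    using \<open>w \<noteq> 0\<close> unfolding r power_mult_distrib[symmetric]
    by (simp add: power_int_minus power_mult_distrib)
  moreover have "qpoch x q r * qpoch y q r * w powi r / (qpoch (q / x) q r * qpoch (q / y) q r)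
    = (qpoch x q r / qpoch (q / x) q r) * (qpoch y q r / qpoch (q / y) q r) * w powi r"
    by simp
  moreover have "\<dots> = ((q / x\<^sup>2) ^ m * (q / y\<^sup>2) ^ m * w powi r)
      * (qpn x q m * qpn y q m / (qpn (q / x) q m * qpn (q / y) q m))"
    unfolding r qpoch_neg_quotient[OF assms(1,2)] qpoch_neg_quotient[OF assms(1,3)]
    by simp
  ultimately show ?thesis unfolding m_def[symmetric] w_def[symmetric] by simp
qed

section \<open>Exchange of the two summations and the final identity\<close>

text \<open>The finite products and the kernel are bounded uniformly, which leaves the majorant C
  |A_r| |w|^n, a product of two summable families.\<close>

lemma bailey_double_summable:
  fixes A :: "int \<Rightarrow> complex"
  assumes q: "norm q < 1" and w: "norm w < 1" and A: "(\<lambda>r. norm (A r)) summable_on UNIV"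
  shows "(\<lambda>(r, n). qpn x q n * qpn y q n * w ^ n * bailey_kernel q (nat \<bar>r\<bar>) n * A r)
    summable_on UNIV \<times> UNIV"
proof -
  obtain X where X: "X > 0" "\<And>n. norm (qpn x q n) \<le> X" using qpn_bounded[OF q] by blast
  obtain Y where Y: "Y > 0" "\<And>n. norm (qpn y q n) \<le> Y" using qpn_bounded[OF q] by blast
  obtain Q where Q: "Q > 0" "\<And>n. norm (inverse (qpn q q n)) \<le> Q"
    using inverse_qpn_bounded[OF q mult_power_neq_1[OF q q]] by blast
  have ker: "norm (bailey_kernel q m n) \<le> Q * Q" for m n
  proof (cases "m \<le> n")
    case True
    then have "norm (bailey_kernel q m n)
        = norm (inverse (qpn q q (n - m))) * norm (inverse (qpn q q (n + m)))"
      unfolding bailey_kernel_def by (simp add: norm_mult[symmetric] divide_inverse)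
    also have "\<dots> \<le> Q * Q" using Q by (intro mult_mono) (auto intro: less_imp_le)
    finally show ?thesis .
  qed (use Q in \<open>simp add: bailey_kernel_def\<close>)
  define C where "C = X * Y * (Q * Q)"
  have C: "C \<ge> 0" using X Y Q by (simp add: C_def)
  have geo: "((\<lambda>n. norm w ^ n) has_sum (1 / (1 - norm w))) UNIV"
    using w by (intro sums_nonneg_imp_has_sum geometric_sums) auto
  have "(\<lambda>(r, n). norm (A r) * C * norm w ^ n) summable_on UNIV \<times> UNIV"
  proof (rule summable_on_SigmaI)
    show "((\<lambda>n. case (r, n) of (r, n) \<Rightarrow> norm (A r) * C * norm w ^ n)
        has_sum (norm (A r) * C * (1 / (1 - norm w)))) UNIV" for r
      using has_sum_cmult_right[OF geo] by simp
    show "(\<lambda>r. norm (A r) * C * (1 / (1 - norm w))) summable_on UNIV"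
      by (intro summable_on_cmult_left A)
  qed (use C in auto)
  then have "(\<lambda>p. norm (case p of (r, n) \<Rightarrow>
      qpn x q n * qpn y q n * w ^ n * bailey_kernel q (nat \<bar>r\<bar>) n * A r)) summable_on UNIV \<times> UNIV"
  proof (rule Infinite_Sum.abs_summable_on_comparison_test', clarify)
    fix r n
    have "norm (qpn x q n * qpn y q n * w ^ n * bailey_kernel q (nat \<bar>r\<bar>) n * A r)
       = norm (qpn x q n) * norm (qpn y q n) * norm (bailey_kernel q (nat \<bar>r\<bar>) n) * (norm (A r) * norm w ^ n)"
      by (simp add: norm_mult norm_power)
    also have "\<dots> \<le> C * (norm (A r) * norm w ^ n)"
      unfolding C_def using X Y Q ker by (intro mult_right_mono mult_mono) (auto intro: less_imp_le)
    finally show "norm (qpn x q n * qpn y q n * w ^ n * bailey_kernel q (nat \<bar>r\<bar>) n * A r)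
        \<le> norm (A r) * C * norm w ^ n" by (simp add: mult_ac)
  qed
  then show ?thesis by (rule abs_summable_summable)
qed

theorem corollary4p2:
  fixes q b z x y :: complex
  assumes "0 < norm q" and "norm q < 1"
    and "z \<noteq> 0" and "z \<noteq> 1"
    and "x \<noteq> 0" and "y \<noteq> 0"
    and "norm (q / (x * y)) < 1"
    and "x \<notin> {q ^ m | m :: nat. m \<ge> 1}"
    and "y \<notin> {q ^ m | m :: nat. m \<ge> 1}"
  defines "L \<equiv> (\<lambda>n :: nat.
      qpoch x q (int n) * qpoch y q (int n) * (1 - b * q ^ n) * (q / (x * y)) ^ n
      * (qpoch (- 1 / z) q (int n) * qpoch (- z) q (int n)) / qpoch q q (int (2 * n)))"
    and "R \<equiv> (\<lambda>n :: int.
      qpoch x q n * qpoch y q n * q powi (n * (n - 1) div 2) * (q / (x * y * z)) powi n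
      / (qpoch (q / x) q n * qpoch (q / y) q n)
      * ((1 - b * q powi n) - z * (q powi n - b)))"
  shows "summable L \<and> R summable_on UNIV \<and>
    (\<Sum>n. L n) =
      1 / (1 - z)
      * ((qpoch_inf (q / x) q * qpoch_inf (q / y) q)
          / (qpoch_inf q q * qpoch_inf (q / (x * y)) q))
      * (\<Sum>\<^sub>\<infinity>n\<in>UNIV. R n)"
proof -
  define w where "w = q / (x * y)"
  define A where "A = theta_coeff q b z"
  define F where "F r n = qpn x q n * qpn y q n * w ^ n * bailey_kernel q (nat \<bar>r\<bar>) n * A r"
    for r n
  define K where "K = qpoch_inf (q / x) q * qpoch_inf (q / y) q / (qpoch_inf q q * qpoch_inf w q)"
  have q: "norm q < 1" "q \<noteq> 0" and w: "norm w < 1" using assms by (auto simp: w_def)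
  \<comment> \<open>The excluded values q^m with m \<ge> 1 are exactly the zeros of
    (q/u)_\<infinity>, with m = j + 1.\<close>
  have ne: "q / u * q ^ j \<noteq> 1" if "u \<notin> {q ^ m | m :: nat. m \<ge> 1}" "u \<noteq> 0" for u j
  proof
    assume "q / u * q ^ j = 1"
    then have "u = q ^ Suc j" using that(2) by (simp add: field_simps)
    then show False using that(1) by (metis (mono_tags, lifting) One_nat_def Suc_le_mono le0 mem_Collect_eq)
  qed
  note xq = ne[OF assms(8,5)] and yq = ne[OF assms(9,6)]
  \<comment> \<open>Needed to pass from summability of K R to that of R.\<close>
  have "K \<noteq> 0"
    using qpoch_inf_nonzero[OF q(1) xq] qpoch_inf_nonzero[OF q(1) yq]
      qpoch_inf_nonzero[OF q(1) mult_power_neq_1[OF q(1) q(1)]]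
      qpoch_inf_nonzero[OF q(1) mult_power_neq_1[OF w q(1)]]
    by (simp add: K_def)
  have F: "(\<lambda>(r, n). F r n) summable_on UNIV \<times> UNIV"
    unfolding F_def A_def
    by (intro bailey_double_summable theta_coeff_abs_summable q w assms)
  \<comment> \<open>For fixed r the sum over n is the q-Gauss value; symmetry in r then restores the
    bilateral summand from |r|.\<close>
  have row: "infsum (F r) UNIV = K * R r" for r
  proof -
    have "F r summable_on UNIV" using summable_on_SigmaD1[OF F] by simp
    then have "F r sums infsum (F r) UNIV" by (intro has_sum_imp_sums has_sum_infsum)
    moreover have "F r sums (K * (qpn x q (nat \<bar>r\<bar>) * qpn y q (nat \<bar>r\<bar>) * w ^ nat \<bar>r\<bar>
        / (qpn (q / x) q (nat \<bar>r\<bar>) * qpn (q / y) q (nat \<bar>r\<bar>))) * A r)"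
      unfolding F_def K_def w_def by (intro sums_mult2 bailey_kernel_sums q xq yq assms)
    ultimately have "infsum (F r) UNIV = K * (qpn x q (nat \<bar>r\<bar>) * qpn y q (nat \<bar>r\<bar>) * w ^ nat \<bar>r\<bar>
        / (qpn (q / x) q (nat \<bar>r\<bar>) * qpn (q / y) q (nat \<bar>r\<bar>))) * A r"
      by (rule sums_unique2)
    also have "\<dots> = K * (qpoch x q r * qpoch y q r * w powi r
        / (qpoch (q / x) q r * qpoch (q / y) q r)) * A r"
      unfolding w_def qpoch_quotient_symmetric[OF q(2) assms(5,6)] ..
    also have "\<dots> = K * R r"
    proof -
      have "q / (x * y * z) = w * (1 / z)" by (simp add: w_def)
      then have "(q / (x * y * z)) powi r = w powi r * (1 / z) powi r"
        by (simp only: power_int_mult_distrib)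
      then show ?thesis by (simp add: R_def A_def theta_coeff_def mult_ac)
    qed
    finally show ?thesis .
  qed
  have col: "infsum (\<lambda>r. F r n) UNIV = (1 - z) * L n" for n
  proof -
    \<comment> \<open>For fixed n the kernel cuts the sum over r down to |r| \<le> n, where the
      Bailey pair identity applies.\<close>
    have "infsum (\<lambda>r. F r n) UNIV = infsum (\<lambda>r. F r n) {- int n..int n}"
      by (rule infsum_cong_neutral) (auto simp: F_def bailey_kernel_def)
    also have "\<dots> = (\<Sum>r=-int n..int n. F r n)" by simp
    also have "\<dots> = (\<Sum>r=-int n..int n. qpn x q n * qpn y q n * w ^ n *
        (A r / (qpn q q (nat (int n - r)) * qpn q q (nat (int n + r)))))"
    proof (rule sum.cong[OF refl])
      fix r assume r: "r \<in> {- int n..int n}"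
      \<comment> \<open>For r < 0 the two factors of the denominator merely change places.\<close>
      have "bailey_kernel q (nat \<bar>r\<bar>) n = 1 / (qpn q q (nat (int n - r)) * qpn q q (nat (int n + r)))"
      proof (cases "r \<ge> 0")
        case True
        then have "n - nat \<bar>r\<bar> = nat (int n - r)" "n + nat \<bar>r\<bar> = nat (int n + r)" "nat \<bar>r\<bar> \<le> n"
          using r by auto
        then show ?thesis by (simp add: bailey_kernel_def)
      next
        case False
        then have "n - nat \<bar>r\<bar> = nat (int n + r)" "n + nat \<bar>r\<bar> = nat (int n - r)" "nat \<bar>r\<bar> \<le> n"
          using r by auto
        then show ?thesis by (simp add: bailey_kernel_def mult.commute)
      qed
      then show "F r n = qpn x q n * qpn y q n * w ^ n *
          (A r / (qpn q q (nat (int n - r)) * qpn q q (nat (int n + r))))"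
        by (simp add: F_def)
    qed
    also have "\<dots> = (1 - z) * L n"
      unfolding sum_distrib_left[symmetric] A_def theta_bailey_pair[OF q assms(3)]
      by (simp only: L_def qpoch_of_nat w_def) simp
    finally show ?thesis .
  qed
  have "(\<lambda>r. infsum (F r) UNIV) summable_on UNIV"
    using F by (rule summable_on_Sigma_banach)
  then have R: "R summable_on UNIV"
    unfolding row using \<open>K \<noteq> 0\<close> by (simp add: summable_on_cmult_right')
  have "(\<lambda>(n, r). F r n) summable_on UNIV \<times> UNIV"
    using iffD1[OF summable_on_swap F] by simp
  then have "(\<lambda>n. infsum (\<lambda>r. F r n) UNIV) summable_on UNIV"
    by (rule summable_on_Sigma_banach)
  then have L: "L summable_on UNIV"
    unfolding col using assms(4) by (simp add: summable_on_cmult_right')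
  \<comment> \<open>\<open>F\<close> summed in both orders; z \<noteq> 1 allows the division by 1 -
    z below.\<close>
  have "(1 - z) * infsum L UNIV = K * infsum R UNIV"
    using infsum_swap_banach[OF F] unfolding row col
    by (simp add: infsum_cmult_right')
  moreover have "(\<Sum>n. L n) = infsum L UNIV"
    using has_sum_imp_sums[OF has_sum_infsum[OF L]] by (rule sums_unique[symmetric])
  ultimately have "(\<Sum>n. L n) = 1 / (1 - z) * K * infsum R UNIV"
    using assms(4) by (simp add: field_simps)
  then show ?thesis
    using R summable_on_imp_summable[OF L] unfolding K_def w_def by simp
qed

end
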